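(* Let $S=\{s(1)<s(2)<\cdots\}$ be a nonempty, finite or infinite, strictly increasing sequence of positive integers, and let $u$ be its characteristic function: $u(n)=1$ if $n\in S$ and $u(n)=0$ otherwise. Let $E(S)$ be the set of positive integers $N$ such that every exponent in the prime power factorization of $N$ belongs to $S$, with the convention $1\in E(S)$. Then $E(S)$ has a natural density $h=h(E(S))$, and: (1) if $s(1)>1$, then $h(E(S))=0$; (2) if $s(1)=1$, then, as $x\to\infty$, $$\sum_{i\leq x,\ i\in E(S)} 1 = h(E(S))\,x+O\!\left(\sqrt{x}\,\log x\; e^{c\frac{\sqrt{\log x}}{\log\log x}}\right),$$ where $c=4\sqrt{\frac{2.4}{\log 2}}=7.443083\ldots$ and $$h(E(S))=\prod_{p}\Big(1+\sum_{i\geq 2}\frac{u(i)-u(i-1)}{p^i}\Big),$$ the product being over all primes $p$.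
   Context: A positive integer whose prime-power exponents all lie in $S$ is called an exponentially $S$-number; $E(S)$ denotes the set of these, and the integer $1$ (which has no prime factors) is included in $E(S)$ by convention. The density of a set $A$ of positive integers means $\lim_{x\to\infty}\frac{1}{x}\#\{i\le x: i\in A\}$. Here $\log$ is the natural logarithm. *)

theory Defs
  imports
    "HOL-Analysis.Analysis"
    "HOL-Computational_Algebra.Primes"
    "HOL-Library.Landau_Symbols"
begin

definition exponentially :: "nat set \<Rightarrow> nat set" where
  "exponentially S = {N. N > 0 \<and> (\<forall>p \<in> prime_factors N. multiplicity p N \<in> S)}"

definition count_upto :: "nat set \<Rightarrow> real \<Rightarrow> nat" where
  "count_upto A x = card {i \<in> A. 0 < i \<and> real i \<le> x}"

definition has_density :: "nat set \<Rightarrow> real \<Rightarrow> bool" where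
  "has_density A h \<longleftrightarrow> ((\<lambda>x. real (count_upto A x) / x) \<longlongrightarrow> h) at_top"

definition remainder_const :: real where
  "remainder_const = 4 * sqrt (2.4 / ln 2)"

text \<open>
  A product over the primes is written as a product over all natural numbers
  in which every index that is not prime contributes the factor 1.
\<close>

definition density_factor :: "nat set \<Rightarrow> nat \<Rightarrow> real" where
  "density_factor S n =
     (if prime n
      then 1 + (\<Sum>\<^sub>\<infinity>i\<in>{2..}. (indicat_real S i - indicat_real S (i - 1)) / real n ^ i)
      else 1)"

end

theory Submission imports Defs begin

text \<open>
  For $1 \in S$ the indicator function of the exponentially $S$-numbers is the Dirichlet convolution
  of the constant $1$ with the multiplicative function $g$ given by $g(p^k) = u(k) - u(k-1)$,
  where $u(0)$ is read as $1$.
  Since $g(p) = 0$ and $|g| \le 1$, the function $g$ lives on the powerful numbers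
  $d = a^2 b^3$, of which there are $O(\sqrt x)$ up to $x$ and for which
  $\sum_{d > x} 1/d = O(1/\sqrt x)$. Hence
  $\sum_{d \le x} g(d) \lfloor x/d \rfloor = x \sum_d g(d)/d + O(\sqrt x)$, which is stronger than
  the claimed remainder, and $\sum_d g(d)/d$ is the Euler product.
  If $1 \notin S$, all exponentially $S$-numbers are powerful.
\<close>

section \<open>Finite Euler products, divisor sums and multiples\<close>

text \<open>Summability of a real family is absolute, so the product family is absolutely summable
  and may be summed one coordinate at a time.\<close>

lemma has_sum_times:
  fixes f :: "'a \<Rightarrow> real" and g :: "'b \<Rightarrow> real"
  assumes f: "(f has_sum a) A" and g: "(g has_sum b) B"
  shows "((\<lambda>(x, y). f x * g y) has_sum a * b) (A \<times> B)"
proof (rule has_sum_SigmaI)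
  show "((\<lambda>y. case (x, y) of (x, y) \<Rightarrow> f x * g y) has_sum f x * b) B" for x
    using has_sum_cmult_right[OF g] by simp
  show "((\<lambda>x. f x * b) has_sum a * b) A"
    by (rule has_sum_cmult_left[OF f])
  have "(\<lambda>x. norm (f x)) summable_on A" "(\<lambda>y. norm (g y)) summable_on B"
    using f g summable_on_iff_abs_summable_on_real[of f A] summable_on_iff_abs_summable_on_real[of g B]
    by (auto simp: summable_on_def)
  then have "(\<lambda>z. norm (case z of (x, y) \<Rightarrow> f x * g y)) summable_on A \<times> B"
    unfolding Infinite_Sum.abs_summable_on_Sigma_iff
    by (auto simp: abs_mult infsum_cmult_right' infsum_nonneg
             intro!: summable_on_cmult_right summable_on_cmult_left)
  then show "(\<lambda>(x, y). f x * g y) summable_on A \<times> B"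
    by (rule Infinite_Sum.abs_summable_summable)
qed

definition smooth_over :: "nat set \<Rightarrow> nat set" where
  "smooth_over P = {n. n > 0 \<and> prime_factors n \<subseteq> P}"

text \<open>This is the Euler product over finitely many primes, by induction on \<open>P\<close>:
  adding a prime q multiplies the sum by one more local series, because every new number is uniquely
  q^k * m with m composed of the old primes. It serves both the divisor sums, with weights of finite
  support, and the partial products of the density.\<close>

lemma has_sum_smooth_over:
  fixes w :: "nat \<Rightarrow> nat \<Rightarrow> real"
  assumes "finite P" "\<And>p. p \<in> P \<Longrightarrow> prime p"
    and "\<And>p. p \<in> P \<Longrightarrow> (w p has_sum F p) UNIV"
  shows "((\<lambda>n. \<Prod>p\<in>P. w p (multiplicity p n)) has_sum (\<Prod>p\<in>P. F p)) (smooth_over P)"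
  using assms
proof (induction P rule: finite_induct)
  case empty
  have "smooth_over {} = {1}"
    by (auto simp: smooth_over_def prime_factorization_empty_iff)
  then show ?case by (simp add: has_sum_finite_iff)
next
  case (insert q P)
  have q: "prime q" using insert.prems by auto
  have mult: "multiplicity q m = 0" if "m \<in> smooth_over P" for m
    using that insert.hyps q
    by (auto simp: smooth_over_def prime_factors_multiplicity)
  have *: "((\<lambda>(k, m). w q k * (\<Prod>p\<in>P. w p (multiplicity p m))) has_sum (F q * (\<Prod>p\<in>P. F p)))
          (UNIV \<times> smooth_over P)"
    using insert by (intro has_sum_times) auto
  have "((\<lambda>n. \<Prod>p\<in>insert q P. w p (multiplicity p n)) has_sum (F q * (\<Prod>p\<in>P. F p)))
          (smooth_over (insert q P))"
  \<comment> \<open>The bijection sends (k, m) to q^k * m; its inverse splits off the full power of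
    q.\<close>
  proof (rule iffD1[OF has_sum_reindex_bij_witness *])
    fix a :: "nat \<times> nat" assume "a \<in> UNIV \<times> smooth_over P"
    then obtain k m where a: "a = (k, m)" "m \<in> smooth_over P" by auto
    have m: "m > 0" "prime_factors m \<subseteq> P" using a by (auto simp: smooth_over_def)
    have mq: "multiplicity q (q ^ k * m) = k"
      using q m mult[OF a(2)] by (simp add: prime_elem_multiplicity_mult_distrib prime_gt_0_nat)
    have mp: "multiplicity p (q ^ k * m) = multiplicity p m" if "p \<in> P" for p
    proof -
      have "prime p" "p \<noteq> q" using that insert by auto
      then show ?thesis using q m
        by (simp add: prime_elem_multiplicity_mult_distrib prime_gt_0_nat multiplicity_distinct_prime_power)
    qed
    show "(\<lambda>n. (multiplicity q n, n div q ^ multiplicity q n)) ((\<lambda>(k, m). q ^ k * m) a) = a"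
      using a mq q by (auto simp: prime_gt_0_nat)
    have "prime_factors (q ^ k * m) \<subseteq> insert q P"
      using m q by (auto simp: prime_factors_product prime_gt_0_nat prime_factorization_prime_power split: if_splits)
    then show "(\<lambda>(k, m). q ^ k * m) a \<in> smooth_over (insert q P)"
      using a m q by (simp add: smooth_over_def prime_gt_0_nat)
    show "(\<Prod>p\<in>insert q P. w p (multiplicity p ((\<lambda>(k, m). q ^ k * m) a))) =
        (case a of (k, m) \<Rightarrow> w q k * (\<Prod>p\<in>P. w p (multiplicity p m)))"
      using insert.hyps mq mp by (simp add: a)
  next
    fix n assume n: "n \<in> smooth_over (insert q P)"
    let ?k = "multiplicity q n"
    have n': "n > 0" "prime_factors n \<subseteq> insert q P" using n by (auto simp: smooth_over_def)
    show eq: "(\<lambda>(k, m). q ^ k * m) (?k, n div q ^ ?k) = n"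
      by (simp add: multiplicity_dvd)
    let ?m = "n div q ^ ?k"
    have m0: "?m > 0" using eq n' by (cases "?m = 0") auto
    have "prime_factors ?m \<subseteq> prime_factors n"
      using eq n' by (intro dvd_prime_factors) (auto, metis dvd_triv_right)
    moreover have "\<not> q dvd ?m"
      using n' q by (intro multiplicity_decompose) auto
    ultimately have "prime_factors ?m \<subseteq> P" using n' by auto
    then show "(?k, ?m) \<in> UNIV \<times> smooth_over P"
      using m0 by (simp add: smooth_over_def)
  qed simp
  then show ?case using insert.hyps by simp
qed

text \<open>The finite Euler product is applied to the primes of n, with v cut off above the
  exponent of p in n. A number made of these primes that does not divide n exceeds the exponent at
  some prime and gets weight 0, so only divisors contribute.\<close>

lemma sum_divisors_prod:
  fixes v :: "nat \<Rightarrow> real" and n :: nat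
  assumes "n > 0" and v0: "v 0 = 1"
  shows "(\<Sum>d | d dvd n. \<Prod>p\<in>prime_factors d. v (multiplicity p d)) =
         (\<Prod>p\<in>prime_factors n. \<Sum>k\<le>multiplicity p n. v k)"
proof -
  define w where "w = (\<lambda>p k. if k \<le> multiplicity p n then v k else 0)"
  have "((\<lambda>d. \<Prod>p\<in>prime_factors n. w p (multiplicity p d)) has_sum
      (\<Prod>p\<in>prime_factors n. \<Sum>k\<le>multiplicity p n. v k)) (smooth_over (prime_factors n))"
  proof (rule has_sum_smooth_over)
    show "(w p has_sum (\<Sum>k\<le>multiplicity p n. v k)) UNIV" for p
      by (rule has_sum_finite_neutralI[where B = "{..multiplicity p n}"]) (auto simp: w_def)
  qed auto
  moreover have "((\<lambda>d. \<Prod>p\<in>prime_factors n. w p (multiplicity p d)) has_sum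
      (\<Sum>d | d dvd n. \<Prod>p\<in>prime_factors d. v (multiplicity p d))) (smooth_over (prime_factors n))"
  proof (rule has_sum_finite_neutralI)
    show "finite {d. d dvd n}" using \<open>n > 0\<close> by simp
    show "{d. d dvd n} \<subseteq> smooth_over (prime_factors n)"
      using \<open>n > 0\<close> dvd_prime_factors[of n] by (auto simp: smooth_over_def intro: Nat.gr0I)
    show "(\<Prod>p\<in>prime_factors n. w p (multiplicity p d)) = 0"
      if d: "d \<in> smooth_over (prime_factors n) - {d. d dvd n}" for d
    proof -
      have "\<not> (\<forall>p. prime p \<longrightarrow> multiplicity p d \<le> multiplicity p n)"
        using d multiplicity_le_imp_dvd[of d n] by (auto simp: smooth_over_def)
      then obtain p where p: "prime p" "multiplicity p d > multiplicity p n"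
        by (auto simp: not_le)
      have "p \<in> prime_factors d" using p by (auto simp: prime_factors_multiplicity)
      then have "p \<in> prime_factors n" using d by (auto simp: smooth_over_def)
      moreover have "w p (multiplicity p d) = 0" using p by (simp add: w_def)
      ultimately show ?thesis by (intro prod_zero) auto
    qed
    have "(\<Prod>p\<in>prime_factors d. v (multiplicity p d)) = (\<Prod>p\<in>prime_factors n. w p (multiplicity p d))"
      if "d dvd n" for d
    proof -
      \<comment> \<open>Since \<open>v 0 = 1\<close>, the primes of n that do not divide d may be
        added to the product.\<close>
      have "(\<Prod>p\<in>prime_factors d. v (multiplicity p d)) = (\<Prod>p\<in>prime_factors n. v (multiplicity p d))"
      proof (rule prod.mono_neutral_left)
        show "prime_factors d \<subseteq> prime_factors n"
          using that \<open>n > 0\<close> by (intro dvd_prime_factors) auto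
        show "\<forall>p\<in>prime_factors n - prime_factors d. v (multiplicity p d) = 1"
          by (auto simp: v0 prime_factors_multiplicity)
      qed simp
      also have "\<dots> = (\<Prod>p\<in>prime_factors n. w p (multiplicity p d))"
        using that \<open>n > 0\<close> by (intro prod.cong) (auto simp: w_def dvd_imp_multiplicity_le)
      finally show ?thesis .
    qed
    then show "(\<Sum>d | d dvd n. \<Prod>p\<in>prime_factors d. v (multiplicity p d)) =
        (\<Sum>d\<in>{d. d dvd n}. \<Prod>p\<in>prime_factors n. w p (multiplicity p d))"
      by (intro sum.cong) auto
  qed
  ultimately show ?thesis by (rule has_sum_unique[symmetric])
qed

lemma card_multiples_atLeastAtMost:
  fixes d X :: nat
  assumes "d > 0"
  shows "card {n \<in> {1..X}. d dvd n} = X div d"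
proof -
  have "bij_betw (\<lambda>k. d * k) {1..X div d} {n \<in> {1..X}. d dvd n}"
  proof (rule bij_betw_byWitness[where f' = "\<lambda>n. n div d"])
    show "(\<lambda>k. d * k) ` {1..X div d} \<subseteq> {n \<in> {1..X}. d dvd n}"
      using assms by (auto simp: less_eq_div_iff_mult_less_eq mult.commute)
    show "(\<lambda>n. n div d) ` {n \<in> {1..X}. d dvd n} \<subseteq> {1..X div d}"
      using assms by (auto simp: div_le_mono less_eq_div_iff_mult_less_eq dvd_imp_le)
  qed (use assms in auto)
  from bij_betw_same_card[OF this] show ?thesis by simp
qed

section \<open>Powerful numbers: their count and the tails of their reciprocals\<close>

definition powerful :: "nat \<Rightarrow> bool" where
  "powerful n \<longleftrightarrow> n > 0 \<and> (\<forall>p\<in>prime_factors n. 2 \<le> multiplicity p n)"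

text \<open>Every exponent m \<ge> 2 is 2j or 2j + 3. So b collects the primes of odd exponent once
  each, and a takes half of what is left. An odd m \<ge> 2 is at least 3, hence the natural
  subtraction m - 3 * (m mod 2) does not truncate.\<close>

lemma powerful_eq_square_times_cube:
  assumes "powerful d"
  obtains a b where "a > 0" "b > 0" "d = a ^ 2 * b ^ 3"
proof
  let ?m = "\<lambda>p. multiplicity p d"
  let ?a = "\<Prod>p\<in>prime_factors d. p ^ ((?m p - 3 * (?m p mod 2)) div 2)"
  let ?b = "\<Prod>p\<in>prime_factors d. p ^ (?m p mod 2)"
  show "?a > 0" "?b > 0" by (auto intro!: prod_pos prime_gt_0_nat)
  have "2 * ((m - 3 * (m mod 2)) div 2) + 3 * (m mod 2) = m" if "2 \<le> m" for m :: nat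
  proof (cases "even m")
    case False
    then obtain k where "m = 2 * k + 1" by (elim oddE)
    with that obtain j where "m = 2 * j + 3" by (cases k) auto
    then show ?thesis by simp
  qed (auto elim!: evenE)
  then have ex: "2 * ((?m p - 3 * (?m p mod 2)) div 2) + 3 * (?m p mod 2) = ?m p"
    if "p \<in> prime_factors d" for p
    using assms that unfolding powerful_def by blast
  have pw: "(p ^ x) ^ 2 * (p ^ y) ^ 3 = p ^ (2 * x + 3 * y)" for p x y :: nat
    by (simp add: power_add power_mult mult.commute flip: power_mult)
  have "(\<Prod>p\<in>prime_factors d. p ^ ?m p) = (\<Prod>p\<in>prime_factors d.
      (p ^ ((?m p - 3 * (?m p mod 2)) div 2)) ^ 2 * (p ^ (?m p mod 2)) ^ 3)"
    by (intro prod.cong refl) (simp only: pw ex)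
  then have "?a ^ 2 * ?b ^ 3 = (\<Prod>p\<in>prime_factors d. p ^ ?m p)"
    by (simp only: prod.distrib prod_power_distrib)
  also have "\<dots> = d" using assms by (intro prime_factorization_nat[symmetric]) (simp add: powerful_def)
  finally show "d = ?a ^ 2 * ?b ^ 3" ..
qed

text \<open>Each d in \<open>D\<close> has at least one representation a^2 * b^3; further
  representations only enlarge the right side, as the weights are nonnegative. Both a and b divide
  d, so \<open>Y\<close> bounds them too.\<close>

lemma sum_powerful_le:
  fixes \<phi> :: "nat \<Rightarrow> real"
  assumes "finite D" and pow: "\<And>d. d \<in> D \<Longrightarrow> powerful d" and nonneg: "\<And>d. \<phi> d \<ge> 0"
    and le: "\<And>d. d \<in> D \<Longrightarrow> d \<le> Y"
  shows "(\<Sum>d\<in>D. \<phi> d) \<le> (\<Sum>b=1..Y. \<Sum>a | a \<in> {1..Y} \<and> a ^ 2 * b ^ 3 \<in> D. \<phi> (a ^ 2 * b ^ 3))"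
proof -
  let ?T = "Sigma {1..Y} (\<lambda>b. {a \<in> {1..Y}. a ^ 2 * b ^ 3 \<in> D})"
  let ?f = "\<lambda>(b, a). a ^ 2 * b ^ 3 :: nat"
  have "D \<subseteq> ?f ` ?T"
  proof
    fix d assume d: "d \<in> D"
    obtain a b where ab: "a > 0" "b > 0" "d = a ^ 2 * b ^ 3"
      using powerful_eq_square_times_cube[OF pow[OF d]] .
    have "a dvd d" "b dvd d" "d > 0" using ab by auto
    then have "a \<le> Y" "b \<le> Y" using le[OF d] dvd_imp_le[of a d] dvd_imp_le[of b d] by auto
    then show "d \<in> ?f ` ?T" using ab d by (intro image_eqI[of _ _ "(b, a)"]) auto
  qed
  then have "(\<Sum>d\<in>D. \<phi> d) \<le> (\<Sum>d\<in>?f ` ?T. \<phi> d)"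
    by (intro sum_mono2 finite_imageI finite_SigmaI) (auto simp: nonneg)
  also have "\<dots> \<le> (\<Sum>t\<in>?T. \<phi> (?f t))"
    by (rule order_trans[OF sum_image_le]) (auto simp: nonneg)
  also have "\<dots> = (\<Sum>b=1..Y. \<Sum>a | a \<in> {1..Y} \<and> a ^ 2 * b ^ 3 \<in> D. \<phi> (a ^ 2 * b ^ 3))"
    by (subst sum.Sigma) (auto simp: case_prod_unfold)
  finally show ?thesis .
qed

text \<open>The value zeta(3/2). The series starts at b = 0, where the term is
  \<open>inverse 0 = 0\<close>.\<close>

definition zeta32 :: real where "zeta32 = (\<Sum>b. inverse (sqrt (real b ^ 3)))"

lemma sqrt_cube_powr: "inverse (sqrt (real b ^ 3)) = real b powr (-3/2)"
proof (cases "b = 0")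
  case False
  then have "sqrt (real b ^ 3) = (real b powr 3) powr (1 / 2)"
    by (simp add: powr_half_sqrt)
  also have "\<dots> = real b powr (3 / 2)" by (simp only: powr_powr) simp
  finally show ?thesis by (simp add: powr_minus)
qed simp

lemma sum_le_zeta32: "(\<Sum>b=1..Y. inverse (sqrt (real b ^ 3))) \<le> zeta32"
  unfolding zeta32_def
  by (rule sum_le_suminf) (auto simp: sqrt_cube_powr summable_real_powr_iff)

lemma zeta32_nonneg: "zeta32 \<ge> 0"
  using sum_le_zeta32[of 0] by simp

lemma sqrt_div_cube: "sqrt (real X / real b ^ 3) = sqrt (real X) * inverse (sqrt (real b ^ 3))"
  unfolding divide_inverse real_sqrt_mult real_sqrt_inverse ..

text \<open>For fixed b, the condition a^2 * b^3 \<le> X leaves at most sqrt(X / b^3) choices of a,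
  and summing b^(-3/2) over b gives the constant.\<close>

lemma card_powerful_le:
  "real (card {d \<in> {1..X}. powerful d}) \<le> zeta32 * sqrt X"
proof -
  let ?D = "{d \<in> {1..X}. powerful d}"
  have "real (card ?D) = (\<Sum>d\<in>?D. 1)" by simp
  also have "\<dots> \<le> (\<Sum>b=1..X. \<Sum>a | a \<in> {1..X} \<and> a ^ 2 * b ^ 3 \<in> ?D. 1)"
    by (rule sum_powerful_le) auto
  also have "\<dots> \<le> (\<Sum>b=1..X. sqrt (real X) * inverse (sqrt (real b ^ 3)))"
  proof (rule sum_mono)
    fix b assume b: "b \<in> {1..X}"
    let ?y = "sqrt (real X / real b ^ 3)"
    have "a \<le> nat \<lfloor>?y\<rfloor>" if "a ^ 2 * b ^ 3 \<le> X" for a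
    proof -
      have "real a ^ 2 * real b ^ 3 \<le> real X"
        using that of_nat_mono[of "a ^ 2 * b ^ 3" X] by simp
      then have "real a ^ 2 \<le> real X / real b ^ 3"
        using b by (simp add: pos_le_divide_eq)
      then have "real a \<le> ?y" by (rule real_le_rsqrt)
      then show ?thesis by (simp add: le_nat_floor)
    qed
    then have "card {a \<in> {1..X}. a ^ 2 * b ^ 3 \<in> ?D} \<le> card {1..nat \<lfloor>?y\<rfloor>}"
      by (intro card_mono) auto
    then have "real (card {a \<in> {1..X}. a ^ 2 * b ^ 3 \<in> ?D}) \<le> real (nat \<lfloor>?y\<rfloor>)"
      by (simp only: card_atLeastAtMost of_nat_le_iff diff_Suc_1 add_Suc_right One_nat_def)
    also have "\<dots> \<le> ?y" by (simp add: of_nat_floor)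
    finally have "real (card {a \<in> {1..X}. a ^ 2 * b ^ 3 \<in> ?D}) \<le> ?y" .
    then show "(\<Sum>a | a \<in> {1..X} \<and> a ^ 2 * b ^ 3 \<in> ?D. 1) \<le> sqrt (real X) * inverse (sqrt (real b ^ 3))"
      by (simp add: sqrt_div_cube)
  qed
  also have "\<dots> \<le> zeta32 * sqrt X"
    using mult_left_mono[OF sum_le_zeta32[of X], of "sqrt X"]
    by (simp add: sum_distrib_left mult.commute)
  finally show ?thesis .
qed

lemma sum_inverse_squares_tail:
  fixes m Y :: nat
  assumes "m \<ge> 1"
  shows "(\<Sum>a=m..Y. 1 / real a ^ 2) \<le> 2 / m"
proof -
  \<comment> \<open>The term -1/Y makes the induction work, since 1/(n+1)^2 \<le> 1/n - 1/(n+1)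
    telescopes. The first term 1/m^2 \<le> 1/m accounts for the second 1/m.\<close>
  have "(\<Sum>a=m..Y. 1 / real a ^ 2) \<le> 2 / m - 1 / Y" if "Y \<ge> m"
    using that
  proof (induction Y rule: dec_induct)
    case base
    have "1 / real m ^ 2 \<le> 1 / real m"
      using assms by (simp add: field_simps power2_eq_square)
    then show ?case by simp
  next
    case (step n)
    have "n > 0" using step(1) assms by simp
    then have "1 / real (Suc n) ^ 2 \<le> 1 / (real n * real (Suc n))"
      by (intro divide_left_mono) (auto simp: power2_eq_square)
    also have "\<dots> = 1 / real n - 1 / real (Suc n)"
      using \<open>n > 0\<close> by (simp add: field_simps)
    finally have "1 / real (Suc n) ^ 2 \<le> 1 / real n - 1 / real (Suc n)" .
    then show ?case using step by simp
  qed
  moreover have "0 \<le> 1 / real Y" by simp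
  ultimately show ?thesis
    by (cases "Y \<ge> m") (force intro: order_trans)+
qed

text \<open>For fixed b, only a > y = sqrt(n / b^3) occur, so the inner sum is at most b^(-3) * 2/y
  = (2 / sqrt n) * b^(-3/2). Summation over b then gives zeta(3/2).\<close>

lemma sum_inverse_powerful_tail_le:
  assumes "finite D" "n \<ge> 1" and D: "\<And>d. d \<in> D \<Longrightarrow> powerful d \<and> d > n"
  shows "(\<Sum>d\<in>D. 1 / real d) \<le> 2 * zeta32 / sqrt n"
proof -
  obtain Y where Y: "\<And>d. d \<in> D \<Longrightarrow> d \<le> Y"
    using \<open>finite D\<close> by (meson finite_nat_set_iff_bounded_le)
  have "(\<Sum>d\<in>D. 1 / real d) \<le> (\<Sum>b=1..Y. \<Sum>a | a \<in> {1..Y} \<and> a ^ 2 * b ^ 3 \<in> D. 1 / real (a ^ 2 * b ^ 3))"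
    using assms Y by (intro sum_powerful_le) auto
  also have "\<dots> \<le> (\<Sum>b=1..Y. 2 / sqrt n * inverse (sqrt (real b ^ 3)))"
  proof (rule sum_mono)
    fix b assume b: "b \<in> {1..Y}"
    define y where "y = sqrt (real n / real b ^ 3)"
    \<comment> \<open>The least integer above y. It is at least 1 even when y < 1, as the bound on
      the tail of inverse squares requires.\<close>
    define m where "m = nat \<lfloor>y\<rfloor> + 1"
    have y: "y > 0" using b assms by (simp add: y_def)
    have m: "y < m" "m \<ge> 1" using y by (auto simp: m_def) linarith
    have "a \<ge> m" if "a ^ 2 * b ^ 3 > n" for a
    proof -
      have "real n < real a ^ 2 * real b ^ 3"
        using that of_nat_less_iff[of n "a ^ 2 * b ^ 3", where 'a = real] by simp
      then have "real n / real b ^ 3 < real a ^ 2"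
        using b by (simp add: pos_divide_less_eq)
      then have "y < a" unfolding y_def by (intro real_less_lsqrt) auto
      then show ?thesis using y by (simp add: m_def) linarith
    qed
    then have "(\<Sum>a | a \<in> {1..Y} \<and> a ^ 2 * b ^ 3 \<in> D. 1 / real (a ^ 2 * b ^ 3)) \<le>
      (\<Sum>a=m..Y. 1 / real (a ^ 2 * b ^ 3))"
      using D by (intro sum_mono2) auto
    also have "\<dots> = inverse (real b ^ 3) * (\<Sum>a=m..Y. 1 / real a ^ 2)"
      by (simp add: sum_distrib_left field_simps)
    also have "\<dots> \<le> inverse (real b ^ 3) * (2 / m)"
      by (intro mult_left_mono sum_inverse_squares_tail m) auto
    also have "\<dots> \<le> inverse (real b ^ 3) * (2 / y)"
      using m y by (intro mult_left_mono divide_left_mono) auto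
    also have "\<dots> = 2 / sqrt n * (sqrt (real b ^ 3) / real b ^ 3)"
      by (simp add: y_def real_sqrt_divide field_simps)
    also have "sqrt (real b ^ 3) / real b ^ 3 = inverse (sqrt (real b ^ 3))"
      by (metis sqrt_divide_self_eq zero_le_power of_nat_0_le_iff)
    finally show "(\<Sum>a | a \<in> {1..Y} \<and> a ^ 2 * b ^ 3 \<in> D. 1 / real (a ^ 2 * b ^ 3)) \<le>
      2 / sqrt n * inverse (sqrt (real b ^ 3))" .
  qed
  also have "\<dots> = 2 / sqrt n * (\<Sum>b=1..Y. inverse (sqrt (real b ^ 3)))"
    by (simp add: sum_distrib_left)
  also have "\<dots> \<le> 2 / sqrt n * zeta32"
    by (intro mult_left_mono sum_le_zeta32) auto
  finally show ?thesis by simp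
qed

section \<open>The multiplicative function g and its convolution with 1\<close>

text \<open>
  For $1 \in S$ this is $u(k) - u(k-1)$ with $u(0)$ read as $1$, so that the partial sums are $u(k)$.
\<close>

definition jump :: "nat set \<Rightarrow> nat \<Rightarrow> real" where
  "jump S k = (if k = 0 then 1 else if k = 1 then 0 else indicat_real S k - indicat_real S (k - 1))"

text \<open>This is g. Because \<open>jump S 0 = 1\<close>, further primes may be added to the
  product without changing it.\<close>

definition jump_prod :: "nat set \<Rightarrow> nat \<Rightarrow> real" where
  "jump_prod S n = (\<Prod>p\<in>prime_factors n. jump S (multiplicity p n))"

lemma abs_jump_le_1: "\<bar>jump S k\<bar> \<le> 1"
  by (simp add: jump_def indicator_def)

lemma abs_jump_prod_le_1: "\<bar>jump_prod S n\<bar> \<le> 1"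
  unfolding jump_prod_def abs_prod by (intro prod_le_1) (auto simp: abs_jump_le_1)

text \<open>A prime of exponent 1 contributes the factor \<open>jump S 1 = 0\<close>. The number 0
  has to be kept out: it is not \<open>powerful\<close>, yet its product is empty and equals
  1.\<close>

lemma jump_prod_not_powerful:
  assumes "n > 0" "\<not> powerful n"
  shows "jump_prod S n = 0"
proof -
  obtain p where "p \<in> prime_factors n" "multiplicity p n < 2"
    using assms by (auto simp: powerful_def not_le)
  moreover from this have "multiplicity p n = 1"
    by (auto simp: prime_factors_multiplicity)
  ultimately show ?thesis
    unfolding jump_prod_def by (intro prod_zero bexI[of _ p]) (auto simp: jump_def)
qed

text \<open>The values at 0 and 1 add up to 1, which is u(1) because 1 lies in S; from there on the
  sum telescopes.\<close>

lemma sum_jump: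
  assumes "1 \<in> S" "k \<ge> 1"
  shows "(\<Sum>i\<le>k. jump S i) = indicat_real S k"
  using assms(2)
proof (induction k rule: dec_induct)
  case base
  have "{..1::nat} = {0, 1}" by auto
  then show ?case using assms(1) by (simp add: jump_def)
next
  case (step n)
  then show ?case by (simp add: jump_def)
qed

text \<open>Multiplicativity reduces the convolution of g with 1 to prime powers, where it is a
  partial sum of \<open>jump\<close>.\<close>

lemma sum_divisors_jump_prod:
  assumes "1 \<in> S" "n > 0"
  shows "(\<Sum>d | d dvd n. jump_prod S d) = indicat_real (exponentially S) n"
proof -
  have "(\<Sum>d | d dvd n. jump_prod S d) = (\<Prod>p\<in>prime_factors n. \<Sum>k\<le>multiplicity p n. jump S k)"
    unfolding jump_prod_def by (rule sum_divisors_prod) (use assms in \<open>auto simp: jump_def\<close>)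
  also have "\<dots> = (\<Prod>p\<in>prime_factors n. indicat_real S (multiplicity p n))"
    by (intro prod.cong refl sum_jump assms) (auto simp: prime_factors_multiplicity)
  also have "\<dots> = indicat_real (exponentially S) n"
    using assms(2) by (auto simp: exponentially_def indicator_def)
  finally show ?thesis .
qed

lemma card_exponentially_eq:
  assumes "1 \<in> S"
  shows "real (card (exponentially S \<inter> {1..X})) = (\<Sum>d=1..X. jump_prod S d * real (X div d))"
proof -
  have "real (card (exponentially S \<inter> {1..X})) = (\<Sum>n=1..X. indicat_real (exponentially S) n)"
    by (simp add: indicator_def sum.If_cases Int_def conj_commute)
  also have "\<dots> = (\<Sum>n=1..X. \<Sum>d | d dvd n. jump_prod S d)"
    using assms by (intro sum.cong refl sum_divisors_jump_prod[symmetric]) auto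
  also have "\<dots> = (\<Sum>n=1..X. \<Sum>d | d \<in> {1..X} \<and> d dvd n. jump_prod S d)"
  proof (intro sum.cong refl)
    fix n assume n: "n \<in> {1..X}"
    show "{d. d dvd n} = {d \<in> {1..X}. d dvd n}"
    proof (intro set_eqI iffI)
      fix d assume "d \<in> {d. d dvd n}"
      then have "d dvd n" "d \<le> n" "d > 0" using n dvd_imp_le[of d n] dvd_pos_nat[of n d] by auto
      then show "d \<in> {d \<in> {1..X}. d dvd n}" using n by simp
    qed auto
  qed
  \<comment> \<open>After the swap, g(d) is counted once for each multiple of d up to X.\<close>
  also have "\<dots> = (\<Sum>d=1..X. \<Sum>n | n \<in> {1..X} \<and> d dvd n. jump_prod S d)"
    by (rule sum.swap_restrict) auto
  also have "\<dots> = (\<Sum>d=1..X. jump_prod S d * real (X div d))"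
  proof (intro sum.cong refl)
    fix d assume "d \<in> {1..X}"
    then show "(\<Sum>n | n \<in> {1..X} \<and> d dvd n. jump_prod S d) = jump_prod S d * real (X div d)"
      using card_multiples_atLeastAtMost[of d X] by simp
  qed
  finally show ?thesis .
qed

section \<open>Absolute bounds for g, the density as a series, and the counting error\<close>

lemma sum_abs_jump_prod_le:
  "(\<Sum>d=1..X. \<bar>jump_prod S d\<bar>) \<le> zeta32 * sqrt X"
proof -
  have "(\<Sum>d=1..X. \<bar>jump_prod S d\<bar>) \<le> (\<Sum>d=1..X. if powerful d then 1 else 0)"
    by (intro sum_mono) (auto simp: abs_jump_prod_le_1 jump_prod_not_powerful)
  also have "\<dots> = real (card {d \<in> {1..X}. powerful d})"
    by (simp add: sum.If_cases Int_def)
  finally show ?thesis using card_powerful_le[of X] by linarith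
qed

lemma sum_abs_jump_prod_tail_le:
  assumes "finite D" "n \<ge> 1" "D \<subseteq> {n<..}"
  shows "(\<Sum>d\<in>D. \<bar>jump_prod S d / real d\<bar>) \<le> 2 * zeta32 / sqrt n"
proof -
  have "(\<Sum>d\<in>D. \<bar>jump_prod S d / real d\<bar>) = (\<Sum>d\<in>{d \<in> D. powerful d}. \<bar>jump_prod S d / real d\<bar>)"
  proof (rule sum.mono_neutral_right)
    show "\<forall>d\<in>D - {d \<in> D. powerful d}. \<bar>jump_prod S d / real d\<bar> = 0"
    proof
      fix d assume "d \<in> D - {d \<in> D. powerful d}"
      then have "d > 0" "\<not> powerful d" using assms by auto
      then show "\<bar>jump_prod S d / real d\<bar> = 0" by (simp add: jump_prod_not_powerful)
    qed
  qed (use assms in auto)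
  also have "\<dots> \<le> (\<Sum>d\<in>{d \<in> D. powerful d}. 1 / real d)"
    by (intro sum_mono) (auto simp: abs_divide abs_jump_prod_le_1 intro!: divide_right_mono)
  also have "\<dots> \<le> 2 * zeta32 / sqrt n"
    using assms by (intro sum_inverse_powerful_tail_le) auto
  finally show ?thesis .
qed

text \<open>The tail bound is uniform over finite subsets, so it yields absolute summability and
  passes to the infinite sum.\<close>

lemma jump_prod_summable_tail:
  assumes "n \<ge> 1" "A \<subseteq> {n<..}"
  shows "(\<lambda>d. jump_prod S d / real d) summable_on A"
    and "\<bar>\<Sum>\<^sub>\<infinity>d\<in>A. jump_prod S d / real d\<bar> \<le> 2 * zeta32 / sqrt n"
proof -
  let ?f = "\<lambda>d. jump_prod S d / real d"
  have le: "(\<Sum>d\<in>F. norm (?f d)) \<le> 2 * zeta32 / sqrt n" if "finite F" "F \<subseteq> A" for F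
    using sum_abs_jump_prod_tail_le[of F n S] that assms by auto
  have abs: "(\<lambda>d. norm (?f d)) summable_on A"
    using le by (intro nonneg_bdd_above_summable_on bdd_aboveI2[where M = "2 * zeta32 / sqrt n"]) auto
  then show "?f summable_on A" by (rule Infinite_Sum.abs_summable_summable)
  have "norm (infsum ?f A) \<le> (\<Sum>\<^sub>\<infinity>d\<in>A. norm (?f d))"
    by (rule norm_infsum_bound[OF abs])
  also have "\<dots> \<le> 2 * zeta32 / sqrt n"
    by (rule infsum_le_finite_sums[OF abs le])
  finally show "\<bar>infsum ?f A\<bar> \<le> 2 * zeta32 / sqrt n" by simp
qed

text \<open>The Dirichlet series of g at 1. For 1 in S it is identified with the Euler product
  further below.\<close>

definition exponentially_density :: "nat set \<Rightarrow> real" where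
  "exponentially_density S = (\<Sum>\<^sub>\<infinity>d\<in>{0<..}. jump_prod S d / real d)"

lemma jump_prod_summable: "(\<lambda>d. jump_prod S d / real d) summable_on {0<..}"
proof -
  have "{0<..} = {1} \<union> {1::nat<..}" by auto
  moreover have "(\<lambda>d. jump_prod S d / real d) summable_on {1} \<union> {1<..}"
    by (rule summable_on_Un_disjoint) (use jump_prod_summable_tail(1)[of 1] in auto)
  ultimately show ?thesis by simp
qed

text \<open>What \<open>B\<close> omits lies above n, so the tail bound applies. The set
  \<open>B\<close> is left open because it will be {1..n} for the counting error and the set of
  n-smooth numbers for the Euler product.\<close>

lemma abs_exponentially_density_minus_le:
  assumes "n \<ge> 1" "{1..n} \<subseteq> B" "B \<subseteq> {0<..}"
  shows "\<bar>exponentially_density S - (\<Sum>\<^sub>\<infinity>d\<in>B. jump_prod S d / real d)\<bar> \<le> 2 * zeta32 / sqrt n"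
proof -
  let ?f = "\<lambda>d. jump_prod S d / real d"
  have "?f summable_on B" "?f summable_on {0<..} - B"
    using jump_prod_summable assms by (auto intro: summable_on_subset_banach)
  then have "infsum ?f (B \<union> ({0<..} - B)) = infsum ?f B + infsum ?f ({0<..} - B)"
    by (intro infsum_Un_disjoint) auto
  moreover have "B \<union> ({0<..} - B) = {0<..}" using assms by auto
  ultimately have "exponentially_density S - infsum ?f B = infsum ?f ({0<..} - B)"
    by (simp add: exponentially_density_def)
  moreover have "{0<..} - B \<subseteq> {n<..}"
  proof
    fix d assume d: "d \<in> {0<..} - B"
    then have "d \<notin> {1..n}" using assms(2) by blast
    then show "d \<in> {n<..}" using d by auto
  qed
  ultimately show ?thesis using jump_prod_summable_tail(2)[of n _ S] assms(1) by metis
qed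

text \<open>The factor 3 is 1 + 2: replacing X div d by X/d costs at most 1 per d, weighted by
  |g(d)|, and completing the series costs X times its tail, which is at most 2 zeta(3/2) / sqrt
  X.\<close>

lemma card_exponentially_error:
  assumes "1 \<in> S" "X \<ge> 1"
  shows "\<bar>real (card (exponentially S \<inter> {1..X})) - exponentially_density S * X\<bar> \<le> 3 * zeta32 * sqrt X"
proof -
  let ?f = "\<lambda>d. jump_prod S d / real d"
  have fl: "\<bar>real (X div d) - real X / real d\<bar> \<le> 1" for d
    using floor_divide_of_nat_eq[of X d, where 'a = real] by linarith
  have "\<bar>(\<Sum>d=1..X. jump_prod S d * real (X div d)) - real X * (\<Sum>d=1..X. ?f d)\<bar>
      = \<bar>\<Sum>d=1..X. jump_prod S d * (real (X div d) - real X / real d)\<bar>"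
    by (simp add: sum_distrib_left sum_subtractf right_diff_distrib mult.commute)
  also have "\<dots> \<le> (\<Sum>d=1..X. \<bar>jump_prod S d\<bar> * 1)"
    by (intro order_trans[OF sum_abs] sum_mono) (simp add: abs_mult mult_left_le fl)
  also have "\<dots> \<le> zeta32 * sqrt X" using sum_abs_jump_prod_le by simp
  finally have 1: "\<bar>(\<Sum>d=1..X. jump_prod S d * real (X div d)) - real X * (\<Sum>d=1..X. ?f d)\<bar> \<le> zeta32 * sqrt X" .
  have "\<bar>exponentially_density S - (\<Sum>d=1..X. ?f d)\<bar> \<le> 2 * zeta32 / sqrt X"
  proof -
    have "{1..X} \<subseteq> {0<..}" by auto
    from abs_exponentially_density_minus_le[OF assms(2) order_refl this, of S] show ?thesis by simp
  qed
  then have "real X * \<bar>exponentially_density S - (\<Sum>d=1..X. ?f d)\<bar> \<le> real X * (2 * zeta32 / sqrt X)"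
    by (rule mult_left_mono) simp
  moreover have "real X * \<bar>exponentially_density S - (\<Sum>d=1..X. ?f d)\<bar> =
      \<bar>real X * (\<Sum>d=1..X. ?f d) - exponentially_density S * X\<bar>"
    by (subst abs_of_nat[symmetric], subst abs_mult[symmetric], subst abs_minus_commute)
       (simp add: right_diff_distrib mult.commute)
  ultimately have "\<bar>real X * (\<Sum>d=1..X. ?f d) - exponentially_density S * X\<bar> \<le> real X * (2 * zeta32 / sqrt X)"
    by (simp only:)
  also have "\<dots> = 2 * zeta32 * (real X / sqrt X)" by simp
  also have "real X / sqrt X = sqrt X" by (rule real_div_sqrt) simp
  finally have 2: "\<bar>real X * (\<Sum>d=1..X. ?f d) - exponentially_density S * X\<bar> \<le> 2 * zeta32 * sqrt X" .
  from 1 2 show ?thesis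
    unfolding card_exponentially_eq[OF assms(1)] by linarith
qed

section \<open>The Euler product of the density\<close>

text \<open>The terms at k = 0 and k = 1 are 1 and 0; from k = 2 on they are those of
  \<open>density_factor\<close>. A geometric series dominates.\<close>

lemma jump_factor_has_sum:
  assumes "prime p"
  shows "((\<lambda>k. jump S k / real p ^ k) has_sum density_factor S p) UNIV"
proof -
  let ?f = "\<lambda>k. jump S k / real p ^ k"
  have p: "real p > 1" using prime_gt_1_nat[OF assms] by simp
  have "summable (\<lambda>k. norm (?f k))"
  proof (rule summable_comparison_test')
    show "summable (\<lambda>k. (1 / real p) ^ k)" using p by (intro summable_geometric) auto
    show "norm (norm (?f k)) \<le> (1 / real p) ^ k" for k
      using p abs_jump_le_1[of S k] by (auto simp: power_divide divide_right_mono)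
  qed
  then have s: "?f summable_on A" for A
    by (rule summable_on_subset_banach[OF norm_summable_imp_summable_on]) auto
  have "(UNIV :: nat set) = {0, 1} \<union> {2..}" by auto
  then have "infsum ?f UNIV = infsum ?f {0, 1} + infsum ?f {2..}"
    using infsum_Un_disjoint[OF s s, of "{0, 1}" "{2..}"] by simp
  also have "infsum ?f {0, 1} = 1" by (simp add: jump_def)
  also have "infsum ?f {2..} = (\<Sum>\<^sub>\<infinity>i\<in>{2..}. (indicat_real S i - indicat_real S (i - 1)) / real p ^ i)"
    by (intro infsum_cong) (auto simp: jump_def)
  finally have "infsum ?f UNIV = density_factor S p"
    using assms by (simp add: density_factor_def)
  then show ?thesis using has_sum_infsum[OF s, of UNIV] by simp
qed

lemma density_factor_ge:
  assumes "prime p" "1 \<in> S"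
  shows "density_factor S p \<ge> 1 - 1 / real p ^ 2"
proof -
  text \<open>With $U = \sum_k u(k) p^{-k}$ and $u(0) = 1$, the factor is $(1 - 1/p) U$, and $U \ge 1 + 1/p$.\<close>
  define u where "u = (\<lambda>k. if k = 0 then 1 else indicat_real S k)"
  let ?f = "\<lambda>k. u k / real p ^ k"
  have p: "real p > 1" using prime_gt_1_nat[OF assms(1)] by simp
  have summ: "summable ?f"
  proof (rule summable_comparison_test')
    show "summable (\<lambda>k. (1 / real p) ^ k)" using p by (intro summable_geometric) auto
    show "norm (?f k) \<le> (1 / real p) ^ k" for k
      using p by (auto simp: power_divide u_def indicator_def)
  qed
  define U where "U = suminf ?f"
  have fU: "?f sums U" unfolding U_def by (rule summable_sums[OF summ])
  have "(\<Sum>k<2. ?f k) \<le> U"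
    unfolding U_def using summ p by (intro sum_le_suminf) (auto simp: u_def)
  then have U: "1 + 1 / real p \<le> U"
    using assms(2) by (simp add: u_def lessThan_nat_numeral eval_nat_numeral)
  \<comment> \<open>Dividing the series by p shifts its coefficients by one place, so the difference
    has coefficients u(k) - u(k-1). At k = 1 this is 0, in agreement with \<open>jump\<close>, as 1
    lies in S.\<close>
  define g where "g = (\<lambda>k. case k of 0 \<Rightarrow> 0 | Suc j \<Rightarrow> 1 / real p * ?f j)"
  have "(\<lambda>k. 1 / real p * ?f k) sums (1 / real p * U)"
    by (rule sums_mult[OF fU])
  then have "(\<lambda>k. g (Suc k)) sums (1 / real p * U - g 0)"
    by (simp add: g_def)
  then have "g sums (1 / real p * U)"
    by (simp add: sums_Suc_iff)
  from sums_diff[OF fU this] have "(\<lambda>k. ?f k - g k) sums (U - 1 / real p * U)" .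
  moreover have "(\<lambda>k. ?f k - g k) = (\<lambda>k. jump S k / real p ^ k)"
  proof
    fix k show "?f k - g k = jump S k / real p ^ k"
    proof (cases k)
      case (Suc j)
      then show ?thesis using assms(2) by (cases j) (simp_all add: u_def g_def jump_def diff_divide_distrib)
    qed (simp add: u_def g_def jump_def)
  qed
  ultimately have "density_factor S p = U - 1 / real p * U"
    by (intro sums_unique2[OF has_sum_imp_sums[OF jump_factor_has_sum[OF assms(1), of S]]]) simp
  also have "\<dots> = (1 - 1 / real p) * U" by (simp add: algebra_simps)
  also have "\<dots> \<ge> (1 - 1 / real p) * (1 + 1 / real p)"
    using U p by (intro mult_left_mono) auto
  also have "(1 - 1 / real p) * (1 + 1 / real p) = 1 - 1 / real p ^ 2"
    by (simp add: algebra_simps power2_eq_square)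
  finally show ?thesis .
qed

text \<open>The product of 1 - 1/i^2 over 2 \<le> i \<le> n telescopes to (n + 1) / (2n), and each
  factor is at least 1 - 1/i^2, trivially so for nonprime i. The uniform bound keeps the limit of
  the partial products away from 0.\<close>

lemma prod_density_factor_ge:
  assumes "1 \<in> S"
  shows "(\<Prod>i\<le>n. density_factor S i) \<ge> 1 / 2"
proof -
  have "(\<Prod>i\<le>n. density_factor S i) \<ge> (real n + 1) / (2 * real n)" if "n \<ge> 1" for n
    using that
  proof (induction n rule: dec_induct)
    case base
    show ?case by (simp add: density_factor_def)
  next
    case (step n)
    have "density_factor S (Suc n) \<ge> 1 - 1 / real (Suc n) ^ 2"
      using density_factor_ge[of "Suc n" S] assms by (cases "prime (Suc n)") (auto simp: density_factor_def)
    moreover have "1 - 1 / real (Suc n) ^ 2 \<ge> 0"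
      using one_le_power[of "real (Suc n)" 2] by (simp del: of_nat_Suc)
    moreover have "(\<Prod>i\<le>n. density_factor S i) \<ge> 0"
      by (rule order_trans[OF _ step.IH]) simp
    ultimately have "(real n + 1) / (2 * real n) * (1 - 1 / real (Suc n) ^ 2) \<le>
        (\<Prod>i\<le>n. density_factor S i) * density_factor S (Suc n)"
      using step.IH by (intro mult_mono) auto
    moreover have "(real n + 1) / (2 * real n) * (1 - 1 / real (Suc n) ^ 2) =
        (real (Suc n) + 1) / (2 * real (Suc n))"
      using step by (simp add: divide_simps power2_eq_square) algebra
    ultimately show ?case by simp
  qed
  moreover have "(real n + 1) / (2 * real n) \<ge> 1 / 2" if "n \<ge> 1"
    using that by (simp add: field_simps)
  ultimately have "(\<Prod>i\<le>n. density_factor S i) \<ge> 1 / 2" if "n \<ge> 1"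
    using that order_trans by blast
  then show ?thesis
    by (cases "n = 0") (simp_all add: density_factor_def)
qed

text \<open>The partial product up to n is the sum of g(d)/d over the n-smooth d. These include 1,
  ..., n, so the difference from the full series is O(1 / sqrt n).\<close>

lemma density_factor_has_prod:
  assumes "1 \<in> S"
  shows "density_factor S has_prod exponentially_density S"
proof -
  let ?P = "\<lambda>n. {p. prime p \<and> p \<le> (n::nat)}"
  have prod_eq: "(\<Prod>i\<le>n. density_factor S i) = (\<Sum>\<^sub>\<infinity>d\<in>smooth_over (?P n). jump_prod S d / real d)" for n
  proof -
    have fin: "finite (?P n)" by (rule finite_subset[of _ "{..n}"]) auto
    have "((\<lambda>d. \<Prod>p\<in>?P n. jump S (multiplicity p d) / real p ^ multiplicity p d) has_sum
        (\<Prod>p\<in>?P n. density_factor S p)) (smooth_over (?P n))"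
      by (rule has_sum_smooth_over[OF fin]) (auto intro: jump_factor_has_sum)
    also have "?this \<longleftrightarrow> ((\<lambda>d. jump_prod S d / real d) has_sum
        (\<Prod>p\<in>?P n. density_factor S p)) (smooth_over (?P n))"
    proof (rule has_sum_cong)
      fix d assume "d \<in> smooth_over (?P n)"
      then have d: "d > 0" "prime_factors d \<subseteq> ?P n" by (auto simp: smooth_over_def)
      have "(\<Prod>p\<in>?P n. jump S (multiplicity p d) / real p ^ multiplicity p d) =
          (\<Prod>p\<in>prime_factors d. jump S (multiplicity p d) / real p ^ multiplicity p d)"
        using d fin by (intro prod.mono_neutral_right) (auto simp: prime_factors_multiplicity jump_def)
      also have "\<dots> = jump_prod S d / real (\<Prod>p\<in>prime_factors d. p ^ multiplicity p d)"
        by (simp add: prod_dividef jump_prod_def)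
      also have "(\<Prod>p\<in>prime_factors d. p ^ multiplicity p d) = d"
        by (rule prime_factorization_nat[symmetric, OF d(1)])
      finally show "(\<Prod>p\<in>?P n. jump S (multiplicity p d) / real p ^ multiplicity p d) = jump_prod S d / real d" .
    qed
    finally have "(\<Sum>\<^sub>\<infinity>d\<in>smooth_over (?P n). jump_prod S d / real d) = (\<Prod>p\<in>?P n. density_factor S p)"
      by (rule infsumI)
    also have "\<dots> = (\<Prod>i\<le>n. density_factor S i)"
      by (rule prod.mono_neutral_left) (auto simp: density_factor_def)
    finally show ?thesis ..
  qed
  have "(\<lambda>n. (\<Prod>i\<le>n. density_factor S i) - exponentially_density S) \<longlonglongrightarrow> 0"
  proof (rule Lim_null_comparison)
    show "\<forall>\<^sub>F n in sequentially. norm ((\<Prod>i\<le>n. density_factor S i) - exponentially_density S) \<le> 2 * zeta32 / sqrt (real n)"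
      using eventually_ge_at_top[of 1]
    proof eventually_elim
      case (elim n)
      have "{1..n} \<subseteq> smooth_over (?P n)"
        by (auto simp: smooth_over_def dest!: dvd_imp_le)
      moreover have "smooth_over (?P n) \<subseteq> {0<..}" by (auto simp: smooth_over_def)
      ultimately show ?case
        using abs_exponentially_density_minus_le[of n _ S] elim by (simp add: prod_eq abs_minus_commute)
    qed
    show "(\<lambda>n. 2 * zeta32 / sqrt (real n)) \<longlonglongrightarrow> 0"
      by (intro real_tendsto_divide_at_top[OF tendsto_const]
          filterlim_compose[OF sqrt_at_top] filterlim_real_sequentially)
  qed
  then have lim: "(\<lambda>n. \<Prod>i\<le>n. density_factor S i) \<longlonglongrightarrow> exponentially_density S"
    by (simp add: LIM_zero_iff)
  \<comment> \<open>Convergence in the sense of \<open>raw_has_prod\<close> demands a nonzero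
    limit.\<close>
  then have "exponentially_density S \<ge> 1 / 2"
    by (rule LIMSEQ_le_const) (use prod_density_factor_ge[OF assms] in blast)
  then show ?thesis using lim by (auto simp: has_prod_def raw_has_prod_def)
qed

section \<open>The case of 1 outside S, and counting up to a real bound\<close>

lemma exponentially_subset_powerful:
  assumes "1 \<notin> S" "\<forall>s\<in>S. s > 0"
  shows "exponentially S \<subseteq> Collect powerful"
proof
  fix n assume n: "n \<in> exponentially S"
  have "2 \<le> multiplicity p n" if "p \<in> prime_factors n" for p
  proof -
    have "multiplicity p n \<in> S" using n that by (simp add: exponentially_def)
    then have "multiplicity p n \<noteq> 1" "multiplicity p n > 0" using assms by auto
    then show ?thesis by simp
  qed
  then show "n \<in> Collect powerful" using n by (simp add: powerful_def exponentially_def)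
qed

lemma count_upto_eq:
  assumes "x \<ge> 0"
  shows "count_upto A x = card (A \<inter> {1..nat \<lfloor>x\<rfloor>})"
proof -
  have "{i \<in> A. 0 < i \<and> real i \<le> x} = A \<inter> {1..nat \<lfloor>x\<rfloor>}"
    using assms by (auto simp: le_nat_iff le_floor_iff)
  then show ?thesis by (simp add: count_upto_def)
qed

text \<open>Replacing x by its floor changes h * x by at most |h|, which is at most |h| sqrt x for x
  \<ge> 1.\<close>

lemma count_upto_error:
  assumes X: "\<And>X. X \<ge> 1 \<Longrightarrow> \<bar>real (card (A \<inter> {1..X})) - h * real X\<bar> \<le> C * sqrt X"
    and "C \<ge> 0" "x \<ge> 1"
  shows "\<bar>real (count_upto A x) - h * x\<bar> \<le> (C + \<bar>h\<bar>) * sqrt x"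
proof -
  let ?X = "nat \<lfloor>x\<rfloor>"
  have x: "real ?X \<le> x" "x \<le> real ?X + 1" "?X \<ge> 1" using assms(3) by (auto simp: le_nat_iff)
  have "\<bar>real (count_upto A x) - h * x\<bar> \<le> \<bar>real (card (A \<inter> {1..?X})) - h * real ?X\<bar> + \<bar>h * (x - real ?X)\<bar>"
    using assms(3) by (simp add: count_upto_eq algebra_simps)
  also have "\<bar>real (card (A \<inter> {1..?X})) - h * real ?X\<bar> \<le> C * sqrt ?X"
    using X x by blast
  also have "\<dots> \<le> C * sqrt x"
    by (intro mult_left_mono real_sqrt_le_mono x assms)
  also have "\<bar>h * (x - real ?X)\<bar> \<le> \<bar>h\<bar> * sqrt x"
  proof -
    have "\<bar>x - real ?X\<bar> \<le> sqrt x" using x real_sqrt_ge_one[OF assms(3)] by linarith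
    then show ?thesis unfolding abs_mult by (intro mult_left_mono) auto
  qed
  finally show ?thesis by (simp add: algebra_simps)
qed

lemma has_density_if_sqrt_error:
  assumes "\<And>x. x \<ge> 1 \<Longrightarrow> \<bar>real (count_upto A x) - h * x\<bar> \<le> C * sqrt x"
  shows "has_density A h"
proof -
  have "((\<lambda>x. real (count_upto A x) / x - h) \<longlongrightarrow> 0) at_top"
  proof (rule Lim_null_comparison)
    show "\<forall>\<^sub>F x in at_top. norm (real (count_upto A x) / x - h) \<le> C / sqrt x"
      using eventually_ge_at_top[of 1]
    proof eventually_elim
      case (elim x)
      have "norm (real (count_upto A x) / x - h) = \<bar>real (count_upto A x) - h * x\<bar> / x"
      proof -
        have "real (count_upto A x) / x - h = (real (count_upto A x) - h * x) / x"
          using elim by (simp add: field_simps)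
        then show ?thesis using elim by (simp add: abs_divide)
      qed
      also have "\<dots> \<le> C * sqrt x / x" using assms elim by (intro divide_right_mono) auto
      also have "\<dots> = C / sqrt x" using elim by (simp add: divide_simps)
      finally show ?case .
    qed
    show "((\<lambda>x. C / sqrt x) \<longlongrightarrow> 0) at_top"
      by (intro real_tendsto_divide_at_top[OF tendsto_const] sqrt_at_top)
  qed
  then show ?thesis unfolding has_density_def by (simp add: LIM_zero_iff)
qed

section \<open>The constant c and the claimed remainder\<close>

lemma remainder_const_bounds: "7.443083 \<le> remainder_const" "remainder_const < 7.443084"
proof -
  \<comment> \<open>Comparing 2.4 / ln 2 with the squares of the claimed bounds divided by 4 removes
    the root; seven decimals of ln 2 then suffice.\<close>
  have ln2: "ln (2::real) \<le> 0.6931472" "0.6931471 \<le> ln (2::real)"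
    using ln_approx_bounds[of 2 7] by (simp_all add: eval_nat_numeral)
  have "ln (2::real) > 0" by simp
  have "(7.443083 / 4)\<^sup>2 \<le> 2.4 / ln (2::real)"
    using ln2 by (simp add: field_simps power2_eq_square)
  then have "7.443083 / 4 \<le> sqrt (2.4 / ln 2)" by (rule real_le_rsqrt)
  then show "7.443083 \<le> remainder_const" by (simp add: remainder_const_def)
  have "2.4 / ln (2::real) < (7.443084 / 4)\<^sup>2"
    using ln2 by (simp add: field_simps power2_eq_square)
  then have "sqrt (2.4 / ln 2) < 7.443084 / 4" by (intro real_less_lsqrt) auto
  then show "remainder_const < 7.443084" by (simp add: remainder_const_def)
qed

lemma sqrt_le_error_term:
  assumes "x \<ge> exp 1"
  shows "sqrt x \<le> sqrt x * ln x * exp (remainder_const * (sqrt (ln x) / ln (ln x)))"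
proof -
  have "x > 0" using assms exp_gt_zero[of 1] by linarith
  then have l: "ln x \<ge> 1" using assms by (simp add: ln_ge_iff)
  \<comment> \<open>At x = \<open>exp 1\<close> the denominator is 0 and the quotient is 0 by
    convention, so the exponent is nonnegative there too.\<close>
  have "remainder_const * (sqrt (ln x) / ln (ln x)) \<ge> 0"
    using remainder_const_bounds(1) l by (intro mult_nonneg_nonneg divide_nonneg_nonneg) auto
  then have "ln x * exp (remainder_const * (sqrt (ln x) / ln (ln x))) \<ge> 1 * 1"
    using l by (intro mult_mono) auto
  then show ?thesis using mult_left_mono[of 1 _ "sqrt x"] \<open>x > 0\<close> by (simp add: mult.assoc)
qed

section \<open>Density and remainder in both cases\<close>

lemma exponentially_sqrt_error:
  assumes "1 \<in> S" "x \<ge> 1"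
  shows "\<bar>real (count_upto (exponentially S) x) - exponentially_density S * x\<bar>
    \<le> (3 * zeta32 + \<bar>exponentially_density S\<bar>) * sqrt x"
  using assms zeta32_nonneg by (intro count_upto_error card_exponentially_error) auto

lemma has_density_exponentially:
  assumes "1 \<in> S"
  shows "has_density (exponentially S) (exponentially_density S)"
  by (rule has_density_if_sqrt_error[OF exponentially_sqrt_error[OF assms]])

lemma exponentially_remainder_bigo:
  assumes "1 \<in> S"
  shows "(\<lambda>x. real (count_upto (exponentially S) x) - exponentially_density S * x)
    \<in> O[at_top](\<lambda>x. sqrt x * ln x * exp (remainder_const * (sqrt (ln x) / ln (ln x))))"
proof (rule bigoI)
  let ?C = "3 * zeta32 + \<bar>exponentially_density S\<bar>"
  have C: "?C \<ge> 0" using zeta32_nonneg by simp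
  show "\<forall>\<^sub>F x in at_top. norm (real (count_upto (exponentially S) x) - exponentially_density S * x)
    \<le> ?C * norm (sqrt x * ln x * exp (remainder_const * (sqrt (ln x) / ln (ln x))))"
    using eventually_ge_at_top[of "exp 1"]
  proof eventually_elim
    case (elim x)
    have "x \<ge> 1" using elim one_le_exp_iff[of 1] by linarith
    then have "norm (real (count_upto (exponentially S) x) - exponentially_density S * x) \<le> ?C * sqrt x"
      using exponentially_sqrt_error[OF assms] by simp
    also have "\<dots> \<le> ?C * (sqrt x * ln x * exp (remainder_const * (sqrt (ln x) / ln (ln x))))"
      by (rule mult_left_mono[OF sqrt_le_error_term[OF elim] C])
    also have "\<dots> \<le> ?C * norm (sqrt x * ln x * exp (remainder_const * (sqrt (ln x) / ln (ln x))))"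
      by (intro mult_left_mono C) simp
    finally show ?case .
  qed
qed

lemma has_density_exponentially_zero:
  assumes "1 \<notin> S" "\<forall>s\<in>S. s > 0"
  shows "has_density (exponentially S) 0"
proof -
  have "real (card (exponentially S \<inter> {1..X})) \<le> zeta32 * sqrt X" for X
  proof -
    have "card (exponentially S \<inter> {1..X}) \<le> card {d \<in> {1..X}. powerful d}"
      using exponentially_subset_powerful[OF assms] by (intro card_mono) auto
    then show ?thesis using card_powerful_le[of X] by linarith
  qed
  then have "\<bar>real (count_upto (exponentially S) x) - 0 * x\<bar> \<le> (zeta32 + \<bar>0\<bar>) * sqrt x" if "x \<ge> 1" for x
    using that zeta32_nonneg by (intro count_upto_error) auto
  then show ?thesis by (rule has_density_if_sqrt_error)
qed

theorem theorem1:
  fixes S :: "nat set"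
  assumes "S \<noteq> {}" and "\<forall>s \<in> S. s > 0"
  shows "\<exists>h. has_density (exponentially S) h \<and>
    (Inf S > 1 \<longrightarrow> h = 0) \<and>
    (Inf S = 1 \<longrightarrow>
       (\<lambda>x. real (count_upto (exponentially S) x) - h * x)
         \<in> O[at_top](\<lambda>x. sqrt x * ln x * exp (remainder_const * (sqrt (ln x) / ln (ln x)))) \<and>
       7.443083 \<le> remainder_const \<and> remainder_const < 7.443084 \<and>
       density_factor S has_prod h)"
proof (cases "1 \<in> S")
  case True
  then have "\<not> Inf S > 1" using wellorder_Inf_le1[OF True] by simp
  then show ?thesis
    using has_density_exponentially[OF True] exponentially_remainder_bigo[OF True]
      density_factor_has_prod[OF True] remainder_const_bounds
    by (intro exI[of _ "exponentially_density S"]) blast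
next
  case False
  \<comment> \<open>The infimum of a nonempty set of naturals is one of its elements, so the second
    implication is vacuous and h = 0 settles the first.\<close>
  then have "Inf S \<noteq> 1" using Inf_nat_def1[OF assms(1)] by metis
  then show ?thesis using has_density_exponentially_zero[OF False assms(2)] by blast
qed

end
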